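(* For integers $k\geq 2$ and $m\geq 1$ let $$f(k,m) = m + b_{k,2}\binom{m}{2} + b_{k,3}\binom{m}{3} + \cdots + b_{k,k}\binom{m}{k},$$ where for $2\le \ell\le k$, $$b_{k,\ell} = \frac{\ell-1}{\ell}\sum_{i=0}^{\ell-1}(-1)^{i}\binom{\ell}{i}\binom{k(\ell-i)}{k}.$$ Let $\mathcal{H}=(V,\mathcal{E})$ be a $k$-uniform hypergraph with $|V|=km$ vertices which has a unique perfect matching. Then $|\mathcal{E}|\le f(k,m)$. Moreover, this bound is tight: for all integers $k\ge 2$ and $m\ge 1$ there exists a $k$-uniform hypergraph on $km$ vertices with a unique perfect matching and exactly $f(k,m)$ edges.
   Context: A $k$-uniform hypergraph $\mathcal{H}=(V,\mathcal{E})$ has edge set $\mathcal{E}\subseteq\binom{V}{k}$. A perfect matching in $\mathcal{H}$ (with $|V|=km$) is a collection of $m$ pairwise disjoint edges whose union is $V$. *)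

theory Defs
  imports Complex_Main "HOL-Library.Ramsey" "HOL-Library.Disjoint_Sets"
begin

definition uniform_hypergraph :: "nat \<Rightarrow> 'a set \<Rightarrow> 'a set set \<Rightarrow> bool" where
  "uniform_hypergraph k V E \<longleftrightarrow> E \<subseteq> nsets V k"

definition perfect_matching :: "nat \<Rightarrow> 'a set \<Rightarrow> 'a set set \<Rightarrow> 'a set set \<Rightarrow> bool" where
  "perfect_matching m V E M \<longleftrightarrow> M \<subseteq> E \<and> card M = m \<and> disjoint M \<and> \<Union>M = V"

(* Real-valued because of the factor (l - 1) / l; the subtraction l - i is on nat, but i < l. *)
definition b_coeff :: "nat \<Rightarrow> nat \<Rightarrow> real" where
  "b_coeff k l = (real l - 1) / real l *
     (\<Sum>i<l. (-1) ^ i * real (l choose i) * real ((k * (l - i)) choose k))"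

definition f_bound :: "nat \<Rightarrow> nat \<Rightarrow> real" where
  "f_bound k m = real m + (\<Sum>l=2..k. b_coeff k l * real (m choose l))"

end

theory Submission
  imports Defs "HOL-Combinatorics.Permutations" "HOL-Number_Theory.Cong"
begin

text \<open>
  Sort the k-sets by the set T of matching edges they meet, and let l be the size of T. For the upper
  bound, the vertices in T can be partitioned into l disjoint k-sets that are all images of a given
  k-set F meeting every block of T, under permutations that permute the blocks of T. If all parts
  were edges, they could replace T in the matching. Averaging over the group of these permutations
  shows that at least one in l of the k-sets meeting exactly the blocks of T is a non-edge, and
  inclusion-exclusion counts these k-sets.

  For tightness, order the blocks and mark a vertex in each. Apart from the blocks, take as edges the
  k-sets that avoid the marked vertex of the first block they meet. Block by block, the marked vertex
  forces its block into every perfect matching. Each of the above partitions contains the marked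
  vertex in exactly one part, so the same averaging gives exactly one non-edge in l.
\<close>

section \<open>Disjoint blocks of equal size and the sets that cross them\<close>

locale block_system =
  fixes k :: nat and L :: "'a set set"
  assumes k_pos: "k > 0" and finite_L: "finite L" and disjoint_L: "disjoint L"
    and card_block: "e \<in> L \<Longrightarrow> card e = k"
begin

lemma finite_block: "e \<in> L \<Longrightarrow> finite e"
  using card_block[of e] k_pos card_ge_0_finite[of e] by simp

lemma finite_vertices: "finite (\<Union>L)"
  using finite_L finite_block by blast

lemma block_unique: "e \<in> L \<Longrightarrow> e' \<in> L \<Longrightarrow> x \<in> e \<Longrightarrow> x \<in> e' \<Longrightarrow> e = e'"
  using disjoint_L by (auto simp: disjoint_def)

lemma card_vertices: "card (\<Union>L) = k * card L"
proof -
  have "card (\<Union>L) = (\<Sum>e\<in>L. card e)"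
    using disjoint_L finite_block
    by (intro card_Union_disjoint) (auto simp: disjoint_def pairwise_def disjnt_def)
  then show ?thesis
    by (simp add: card_block)
qed

text \<open>Lets every result about a whole block system be applied to the blocks that a given
  \<open>k\<close>-set meets.\<close>

lemma subsystem: "L' \<subseteq> L \<Longrightarrow> block_system k L'"
  using k_pos finite_L disjoint_L card_block
  by unfold_locales (auto intro: finite_subset simp: disjoint_def)

end

text \<open>As \<open>T\<close> runs through the subfamilies of a block system \<open>L\<close>, the
  classes \<open>crossing k T\<close> partition the \<open>k\<close>-subsets of
  \<open>\<Union>L\<close>; all counting is done class by class.\<close>

definition crossing :: "nat \<Rightarrow> 'a set set \<Rightarrow> 'a set set" where
  "crossing k L = {F \<in> nsets (\<Union>L) k. \<forall>e\<in>L. F \<inter> e \<noteq> {}}"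

context block_system
begin

lemma finite_crossing: "finite (crossing k L)"
  unfolding crossing_def using finite_imp_finite_nsets[OF finite_vertices] by simp

text \<open>On a block \<open>e\<close>, the points of \<open>F \<inter> e\<close> keep their names,
  and \<open>e - F\<close> is matched with \<open>F - e\<close>, which has the same size. Since the
  blocks are disjoint, these maps glue to a single \<open>c\<close>. Block and label together then
  serve as coordinates of a vertex.\<close>

lemma exists_labelling:
  assumes "finite F" "card F = k"
  shows "\<exists>c. (\<forall>e\<in>L. bij_betw c e F) \<and> (\<forall>x \<in> F \<inter> \<Union>L. c x = x)"
proof -
  have "\<exists>c. bij_betw c e F \<and> (\<forall>x \<in> F \<inter> e. c x = x)" if e: "e \<in> L" for e
  proof -
    have "card (e - F) = card (F - e)"
      using card_block[OF e] finite_block[OF e] assms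
      by (simp add: card_Diff_subset_Int Int_commute)
    then obtain h where h: "bij_betw h (e - F) (F - e)"
      using finite_same_card_bij[of "e - F" "F - e"] finite_block[OF e] assms by auto
    define c where "c x = (if x \<in> F then x else h x)" for x
    have "bij_betw c (e \<inter> F) (F \<inter> e)"
      by (rule bij_betwI[where g = id]) (auto simp: c_def)
    moreover have "bij_betw c (e - F) (F - e)"
      using h bij_betw_cong[of "e - F" c h "F - e"] by (simp add: c_def)
    ultimately have "bij_betw c (e \<inter> F \<union> (e - F)) (F \<inter> e \<union> (F - e))"
      by (rule bij_betw_combine) blast
    moreover have "e \<inter> F \<union> (e - F) = e" "F \<inter> e \<union> (F - e) = F" by blast+
    ultimately have "bij_betw c e F" by simp
    then show ?thesis by (auto simp: c_def)
  qed
  then obtain c where c: "\<And>e. e \<in> L \<Longrightarrow> bij_betw (c e) e F \<and> (\<forall>x \<in> F \<inter> e. c e x = x)"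
    by metis
  have "\<forall>x\<in>\<Union>L. \<exists>e. e \<in> L \<and> x \<in> e" by blast
  then obtain b where b': "\<And>x. x \<in> \<Union>L \<Longrightarrow> b x \<in> L \<and> x \<in> b x" by metis
  have b: "b x = e" if "e \<in> L" "x \<in> e" for x e
    using that b'[of x] block_unique[of "b x" e x] by auto
  have "bij_betw (\<lambda>x. c (b x) x) e F" if e: "e \<in> L" for e
  proof -
    have "bij_betw (\<lambda>x. c (b x) x) e F \<longleftrightarrow> bij_betw (c e) e F"
      by (rule bij_betw_cong) (simp add: b[OF e])
    then show ?thesis using c[OF e] by simp
  qed
  then show ?thesis
    using c b by (intro exI[of _ "\<lambda>x. c (b x) x"]) auto
qed

section \<open>The symmetry group of a block system: a wreath product of symmetric groups\<close>

definition sym_group :: "('a \<Rightarrow> 'a) set" where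
  "sym_group = {h. h permutes \<Union>L \<and> (\<lambda>e. h ` e) ` L = L}"

lemma finite_sym_group: "finite sym_group"
  unfolding sym_group_def using finite_permutations[OF finite_vertices] by (rule rev_finite_subset) auto

lemma id_sym_group: "id \<in> sym_group"
  by (auto simp: sym_group_def permutes_id)

lemma comp_sym_group: "g \<in> sym_group \<Longrightarrow> h \<in> sym_group \<Longrightarrow> g \<circ> h \<in> sym_group"
proof -
  assume gh: "g \<in> sym_group" "h \<in> sym_group"
  have "(\<lambda>e. (g \<circ> h) ` e) ` L = (\<lambda>e. g ` e) ` (\<lambda>e. h ` e) ` L"
    by (simp only: image_comp[symmetric] image_image)
  also have "\<dots> = L" using gh by (simp add: sym_group_def)
  finally show ?thesis using gh by (simp add: sym_group_def permutes_compose)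
qed

lemma inv_sym_group:
  assumes "g \<in> sym_group" shows "inv g \<in> sym_group"
proof -
  have g: "g permutes \<Union>L" "(\<lambda>e. g ` e) ` L = L"
    using assms by (auto simp: sym_group_def)
  have "inv g ` g ` e = e" for e
    using permutes_inj[OF g(1)] by (rule image_inv_f_f)
  then have "(\<lambda>e. inv g ` e) ` (\<lambda>e. g ` e) ` L = L"
    by (simp only: image_image[of "(`) (inv g)"] image_ident)
  then have "(\<lambda>e. inv g ` e) ` L = L" by (simp only: g(2))
  then show ?thesis using g(1) by (simp add: sym_group_def permutes_inv)
qed

lemma image_crossing:
  assumes "h \<in> sym_group" "F \<in> crossing k L"
  shows "h ` F \<in> crossing k L"
proof -
  have h: "h permutes \<Union>L" "(\<lambda>e. h ` e) ` L = L" using assms by (auto simp: sym_group_def)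
  have "h ` F \<inter> e \<noteq> {}" if "e \<in> L" for e
  proof -
    have "e \<in> (\<lambda>e. h ` e) ` L" using that h(2) by simp
    then obtain e' where "e' \<in> L" "e = h ` e'" by blast
    then show ?thesis using assms(2) by (auto simp: crossing_def)
  qed
  moreover have "h ` F \<subseteq> h ` \<Union>L"
    using assms(2) by (intro image_mono) (simp add: crossing_def nsets_def)
  then have "h ` F \<subseteq> \<Union>L" by (simp only: permutes_image[OF h(1)])
  moreover have "card (h ` F) = card F"
    by (rule card_image) (rule inj_on_subset[OF permutes_inj[OF h(1)] subset_UNIV])
  ultimately show ?thesis using assms(2) by (auto simp: crossing_def nsets_def)
qed

lemma bij_betw_image_crossing:
  assumes "h \<in> sym_group"
  shows "bij_betw ((`) h) (crossing k L) (crossing k L)"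
proof (rule bij_betwI[where g = "(`) (inv h)"])
  have h: "h permutes \<Union>L" using assms by (auto simp: sym_group_def)
  show "(`) h \<in> crossing k L \<rightarrow> crossing k L" using image_crossing[OF assms] by auto
  show "(`) (inv h) \<in> crossing k L \<rightarrow> crossing k L" using image_crossing[OF inv_sym_group[OF assms]] by auto
  show "inv h ` h ` F = F" for F using permutes_inj[OF h] by (simp add: image_inv_f_f)
  show "h ` inv h ` F = F" for F using permutes_surj[OF h] by (simp add: image_f_inv_f)
qed

text \<open>Right translation in the group; it lets a sum over all symmetries absorb a fixed
  rotation.\<close>

lemma bij_betw_comp_sym_group:
  assumes "g \<in> sym_group"
  shows "bij_betw (\<lambda>h. h \<circ> g) sym_group sym_group"
proof (rule bij_betwI[where g = "\<lambda>h. h \<circ> inv g"])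
  have g: "g permutes \<Union>L" using assms by (auto simp: sym_group_def)
  show "(\<lambda>h. h \<circ> g) \<in> sym_group \<rightarrow> sym_group" using comp_sym_group assms by auto
  show "(\<lambda>h. h \<circ> inv g) \<in> sym_group \<rightarrow> sym_group" using comp_sym_group inv_sym_group[OF assms] by auto
  show "h \<circ> g \<circ> inv g = h" "h \<circ> inv g \<circ> g = h" for h
    using permutes_inv_o[OF g] by (simp_all add: comp_assoc)
qed

section \<open>Partitions into crossing sets, and averaging over them\<close>

definition crossing_partition :: "(nat \<Rightarrow> 'a set) \<Rightarrow> bool" where
  "crossing_partition P \<longleftrightarrow> P ` {..<card L} \<subseteq> crossing k L \<and>
     disjoint_family_on P {..<card L} \<and> (\<Union>j<card L. P j) = \<Union>L"

lemma image_crossing_partition: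
  assumes "h \<in> sym_group" "crossing_partition P"
  shows "crossing_partition (\<lambda>j. h ` P j)"
proof -
  have h: "h permutes \<Union>L" using assms by (auto simp: sym_group_def)
  have "(\<Union>j<card L. h ` P j) = \<Union>L"
    using assms(2) permutes_image[OF h] by (simp add: crossing_partition_def flip: image_UN)
  moreover have "(\<lambda>j. h ` P j) ` {..<card L} \<subseteq> crossing k L"
    using assms image_crossing by (auto simp: crossing_partition_def)
  moreover have "disjoint_family_on (\<lambda>j. h ` P j) {..<card L}"
    using assms(2) permutes_inj[OF h]
    unfolding crossing_partition_def disjoint_family_on_def by (metis image_Int image_empty)
  ultimately show ?thesis
    by (simp add: crossing_partition_def)
qed

(* With vertices labelled bijectively by F on every block, F identically on itself, rotating the
   blocks cyclically while keeping labels moves F through a partition. *)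
lemma exists_rotations:
  assumes F: "F \<in> crossing k L"
  shows "\<exists>g. (\<forall>j<card L. g j \<in> sym_group) \<and> crossing_partition (\<lambda>j. g j ` F)"
proof -
  let ?l = "card L"
  have FU: "F \<subseteq> \<Union>L" and finF: "finite F" and cardF: "card F = k"
    using F by (auto simp: crossing_def nsets_def)
  obtain c where c: "\<And>e. e \<in> L \<Longrightarrow> bij_betw c e F" and cF: "\<And>x. x \<in> F \<Longrightarrow> c x = x"
    using exists_labelling[OF finF cardF] FU by blast
  obtain e where e: "bij_betw e {..<?l} L"
    using ex_bij_betw_nat_finite[OF finite_L] by (auto simp: atLeast0LessThan)
  have eL: "e i \<in> L" if "i < ?l" for i using e that by (auto simp: bij_betw_def)
  have einj: "i = i'" if "i < ?l" "i' < ?l" "x \<in> e i" "x \<in> e i'" for i i' x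
  proof -
    have "e i = e i'" using block_unique[of "e i" "e i'" x] eL that by simp
    then show ?thesis using e that by (auto simp: bij_betw_def dest: inj_onD)
  qed
  have "\<exists>i<?l. x \<in> e i" if x: "x \<in> \<Union>L" for x
  proof -
    have "x \<in> \<Union>(e ` {..<?l})" using x e by (simp add: bij_betw_def)
    then show ?thesis by auto
  qed
  then obtain b where b: "\<And>x. x \<in> \<Union>L \<Longrightarrow> b x < ?l \<and> x \<in> e (b x)" by metis
  have b_eq: "b x = i" if "i < ?l" "x \<in> e i" for x i
  proof -
    have "x \<in> \<Union>L" using eL that by blast
    then show ?thesis using b[of x] einj[of "b x" i x] that by simp
  qed
  \<comment> \<open>The inverse of the coordinates: \<open>\<psi> i f\<close> is the vertex of block
    \<open>e i\<close> with label \<open>f\<close>, so a vertex \<open>x\<close> corresponds to the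
    pair of \<open>b x\<close> and \<open>c x\<close>.\<close>
  define \<psi> where "\<psi> i f = inv_into (e i) c f" for i f
  have \<psi>: "\<psi> i f \<in> e i" "c (\<psi> i f) = f" if "i < ?l" "f \<in> F" for i f
    using c[OF eL[OF that(1)]] that(2) unfolding \<psi>_def
    by (simp_all add: bij_betw_def inv_into_into f_inv_into_f)
  have \<psi>c: "\<psi> (b x) (c x) = x" if "x \<in> \<Union>L" for x
    using c[OF eL[of "b x"]] b[OF that] unfolding \<psi>_def by (simp add: bij_betw_def inv_into_f_f)
  have cin: "c x \<in> F" if x: "x \<in> \<Union>L" for x
  proof -
    obtain d where "d \<in> L" "x \<in> d" using x by blast
    then show ?thesis using c[of d] by (auto simp: bij_betw_def)
  qed
  have b\<psi>: "b (\<psi> i f) = i" if "i < ?l" "f \<in> F" for i f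
    using b_eq \<psi> that by blast
  have \<psi>U: "\<psi> i f \<in> \<Union>L" if "i < ?l" "f \<in> F" for i f
    using eL \<psi> that by blast
  \<comment> \<open>Rotation by \<open>j\<close>: the block index is shifted modulo
    \<open>?l\<close> and the label is kept. Outside \<open>\<Union>L\<close> it is the identity, as
    \<open>permutes\<close> demands.\<close>
  define g where "g j x = (if x \<in> \<Union>L then \<psi> ((b x + j) mod ?l) (c x) else x)" for j x
  have g_e: "g j ` e i \<subseteq> e ((i + j) mod ?l)" if "i < ?l" for i j
  proof
    fix y assume "y \<in> g j ` e i"
    then obtain x where x: "x \<in> e i" "y = g j x" by blast
    then have xU: "x \<in> \<Union>L" using eL[OF that] by blast
    then have "y = \<psi> ((i + j) mod ?l) (c x)" using x b_eq[OF that] by (simp add: g_def)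
    then show "y \<in> e ((i + j) mod ?l)" using \<psi>(1) cin[OF xU] that by simp
  qed
  \<comment> \<open>A vertex witnesses \<open>?l > 0\<close>, which reduction modulo
    \<open>?l\<close> requires.\<close>
  have l_mod_less: "i mod ?l < ?l" if "x \<in> \<Union>L" for x i
    by (rule mod_less_divisor) (use b[OF that] in linarith)
  have gU: "g j x = \<psi> ((b x + j) mod ?l) (c x)" if "x \<in> \<Union>L" for j x
    unfolding g_def using that by (rule if_P)
  have c_g: "c (g j x) = c x" if "x \<in> \<Union>L" for j x
    unfolding gU[OF that] by (rule \<psi>(2)[OF l_mod_less[OF that] cin[OF that]])
  have b_g: "b (g j x) = (b x + j) mod ?l" if "x \<in> \<Union>L" for j x
    unfolding gU[OF that] by (rule b\<psi>[OF l_mod_less[OF that] cin[OF that]])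
  have g_inj: "inj_on (g j) (\<Union>L)" for j
  proof (rule inj_onI)
    fix x y assume xy: "x \<in> \<Union>L" "y \<in> \<Union>L" "g j x = g j y"
    have "c x = c y" using c_g[OF xy(1)] c_g[OF xy(2)] xy(3) by metis
    moreover have "(b x + j) mod ?l = (b y + j) mod ?l"
      using b_g[OF xy(1)] b_g[OF xy(2)] xy(3) by metis
    then have "b x mod ?l = b y mod ?l"
      using cong_add_rcancel_nat[of "b x" j "b y" ?l] by (simp add: cong_def)
    then have "b x = b y" using b[OF xy(1)] b[OF xy(2)] by (metis mod_less)
    ultimately show "x = y" using \<psi>c[OF xy(1)] \<psi>c[OF xy(2)] by metis
  qed
  have g_perm: "g j permutes \<Union>L" for j
  proof (rule inj_imp_permutes[OF g_inj finite_vertices])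
    show "g j x \<in> \<Union>L" if "x \<in> \<Union>L" for x
      unfolding gU[OF that] by (rule \<psi>U[OF l_mod_less[OF that] cin[OF that]])
  qed (simp add: g_def)
  have g_block: "g j ` e i = e ((i + j) mod ?l)" if "i < ?l" for i j
  proof (rule card_subset_eq)
    have l: "(i + j) mod ?l < ?l" using that by simp
    show "finite (e ((i + j) mod ?l))" using finite_block eL l by blast
    show "card (g j ` e i) = card (e ((i + j) mod ?l))"
      using card_image[OF inj_on_subset[OF permutes_inj[OF g_perm] subset_UNIV]]
        card_block[OF eL[OF that]] card_block[OF eL[OF l]] by simp
  qed (rule g_e[OF that])
  have "(\<lambda>d. g j ` d) ` L = L" for j
  proof (rule card_subset_eq[OF finite_L])
    show "(\<lambda>d. g j ` d) ` L \<subseteq> L"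
    proof
      fix d assume "d \<in> (\<lambda>d. g j ` d) ` L"
      then obtain d' where "d' \<in> e ` {..<?l}" "d = g j ` d'" using e by (auto simp: bij_betw_def)
      then obtain i where "i < ?l" "d = g j ` e i" by auto
      then show "d \<in> L" using g_block eL by simp
    qed
    show "card ((\<lambda>d. g j ` d) ` L) = card L"
      using permutes_inj[OF g_perm[of j]] by (intro card_image inj_onI) (simp add: inj_image_eq_iff)
  qed
  then have gG: "g j \<in> sym_group" for j using g_perm by (simp add: sym_group_def)
  have "disjoint_family_on (\<lambda>j. g j ` F) {..<?l}"
    unfolding disjoint_family_on_def
  proof (intro ballI impI)
    fix i j assume ij: "i \<in> {..<?l}" "j \<in> {..<?l}" "i \<noteq> j"
    \<comment> \<open>Rotations keep labels, and points of \<open>F\<close> are their own labels, so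
      a common image forces \<open>f = h\<close>; comparing block indices then forces
      \<open>i = j\<close>.\<close>
    have False if fh: "f \<in> F" "h \<in> F" "g i f = g j h" for f h
    proof -
      have U: "f \<in> \<Union>L" "h \<in> \<Union>L" using fh FU by auto
      have "f = h" using c_g[OF U(1), of i] c_g[OF U(2), of j] cF[OF fh(1)] cF[OF fh(2)] fh(3) by simp
      then have "(i + b f) mod ?l = (j + b f) mod ?l"
        using b_g[OF U(1), of i] b_g[OF U(2), of j] fh(3) by (simp only: add.commute)
      then have "i mod ?l = j mod ?l"
        using cong_add_rcancel_nat[of i "b f" j ?l] by (simp add: cong_def)
      then show False using ij by simp
    qed
    then show "g i ` F \<inter> g j ` F = {}" by blast
  qed
  moreover have "x \<in> (\<Union>j<?l. g j ` F)" if x: "x \<in> \<Union>L" for x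
  proof -
    have fF: "c x \<in> F" by (rule cin[OF x])
    then have fU: "c x \<in> \<Union>L" using FU by blast
    \<comment> \<open>The point of \<open>F\<close> with the label of \<open>x\<close> is
      \<open>c x\<close> itself, and \<open>j\<close> is the shift from its block to that of
      \<open>x\<close>. Adding \<open>?l\<close> keeps the subtraction on \<open>nat\<close> from
      truncating.\<close>
    define j where "j = (b x + ?l - b (c x)) mod ?l"
    have "b (c x) < ?l" "b x < ?l" using b[OF fU] b[OF x] by auto
    then have "(b (c x) + j) mod ?l = b x"
      by (simp add: j_def mod_add_right_eq)
    then have "g j (c x) = x"
      using gU[OF fU, of j] cF[OF fF] \<psi>c[OF x] by simp
    moreover have "j < ?l" unfolding j_def by (rule l_mod_less[OF x])
    ultimately show ?thesis using fF by (metis UN_I image_eqI lessThan_iff)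
  qed
  moreover have gS: "g j ` F \<in> crossing k L" for j
    by (rule image_crossing[OF gG F])
  then have "g j ` F \<subseteq> \<Union>L" for j
    by (simp add: crossing_def nsets_def)
  ultimately have "crossing_partition (\<lambda>j. g j ` F)"
    unfolding crossing_partition_def by (intro conjI image_subsetI gS subset_antisym UN_least subsetI) blast+
  then show ?thesis using gG by blast
qed

text \<open>Apply the hypothesis to the rotations of every crossing set \<open>F\<close>, moved by
  every symmetry \<open>h\<close>, and add up. Summing over both \<open>F\<close> and
  \<open>h\<close> makes each crossing set occur equally often as the \<open>j\<close>-th part, for
  each \<open>j\<close>, so the total is a multiple of the plain sum of \<open>w\<close>.\<close>

lemma crossing_averaging:
  fixes w :: "'a set \<Rightarrow> real" and t :: real
  assumes w: "\<And>P. crossing_partition P \<Longrightarrow> t \<le> (\<Sum>j<card L. w (P j))"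
  shows "t * card (crossing k L) \<le> card L * (\<Sum>F\<in>crossing k L. w F)"
proof -
  let ?G = "sym_group" and ?S = "crossing k L"
  obtain g where g: "\<And>F j. F \<in> ?S \<Longrightarrow> j < card L \<Longrightarrow> g F j \<in> ?G"
    and P: "\<And>F. F \<in> ?S \<Longrightarrow> crossing_partition (\<lambda>j. g F j ` F)"
    using exists_rotations by metis
  have "real (card ?G) * (t * card ?S) = (\<Sum>h\<in>?G. \<Sum>F\<in>?S. t)"
    by simp
  also have "\<dots> \<le> (\<Sum>h\<in>?G. \<Sum>F\<in>?S. \<Sum>j<card L. w (h ` g F j ` F))"
    by (intro sum_mono w image_crossing_partition P)
  also have "\<dots> = (\<Sum>F\<in>?S. \<Sum>h\<in>?G. \<Sum>j<card L. w (h ` g F j ` F))"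
    by (rule sum.swap)
  also have "\<dots> = (\<Sum>F\<in>?S. \<Sum>j<card L. \<Sum>h\<in>?G. w (h ` g F j ` F))"
    by (rule sum.cong[OF refl], rule sum.swap)
  \<comment> \<open>For fixed \<open>F\<close> and \<open>j\<close>, the product of \<open>h\<close>
    and \<open>g F j\<close> runs through the whole group as \<open>h\<close> does.\<close>
  also have "\<dots> = (\<Sum>F\<in>?S. \<Sum>j<card L. \<Sum>h\<in>?G. w (h ` F))"
  proof (rule sum.cong[OF refl], rule sum.cong[OF refl])
    fix F j assume "F \<in> ?S" "j \<in> {..<card L}"
    then show "(\<Sum>h\<in>?G. w (h ` g F j ` F)) = (\<Sum>h\<in>?G. w (h ` F))"
      using sum.reindex_bij_betw[OF bij_betw_comp_sym_group[OF g], of F j "\<lambda>h. w (h ` F)"]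
      by (simp add: image_comp)
  qed
  also have "\<dots> = card L * (\<Sum>h\<in>?G. \<Sum>F\<in>?S. w (h ` F))"
    using sum.swap[of "\<lambda>F h. w (h ` F)" ?G ?S] by (simp add: sum_distrib_left[symmetric])
  also have "(\<Sum>h\<in>?G. \<Sum>F\<in>?S. w (h ` F)) = (\<Sum>h\<in>?G. \<Sum>F\<in>?S. w F)"
    by (rule sum.cong[OF refl]) (rule sum.reindex_bij_betw[OF bij_betw_image_crossing])
  finally have "real (card ?G) * (t * card ?S) \<le> card ?G * (card L * (\<Sum>F\<in>?S. w F))"
    by (simp add: mult_ac)
  moreover have "0 < card ?G"
    using finite_sym_group id_sym_group card_gt_0_iff by blast
  ultimately show ?thesis by simp
qed

end

subsection \<open>Counting sets by the blocks they meet\<close>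

text \<open>Grouping subsets by size turns sums over families of blocks into the binomial sums of
  \<open>f_bound\<close> and \<open>b_coeff\<close>.\<close>

lemma sum_Pow_by_card:
  fixes f :: "nat \<Rightarrow> real"
  assumes "finite A"
  shows "(\<Sum>T\<in>Pow A. f (card T)) = (\<Sum>j\<le>card A. f j * (card A choose j))"
proof -
  have "(\<Sum>T\<in>Pow A. f (card T)) = (\<Sum>j\<le>card A. \<Sum>T\<in>{T \<in> Pow A. card T = j}. f (card T))"
    using assms by (intro sum.group[symmetric]) (auto intro: card_mono)
  also have "\<dots> = (\<Sum>j\<le>card A. f j * (card A choose j))"
    using n_subsets[OF assms] by (intro sum.cong) auto
  finally show ?thesis .
qed

context block_system
begin

text \<open>Each \<open>k\<close>-set lies in exactly one class, given by the blocks it touches. The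
  weight allows counting all \<open>k\<close>-sets as well as only the edges.\<close>

lemma sum_nsets_by_crossing:
  fixes w :: "'a set \<Rightarrow> real"
  shows "sum w (nsets (\<Union>L) k) = (\<Sum>T\<in>Pow L. sum w (crossing k T))"
proof -
  define touched where "touched F = {e \<in> L. F \<inter> e \<noteq> {}}" for F
  have eq: "{F \<in> nsets (\<Union>L) k. touched F = T} = crossing k T" if T: "T \<subseteq> L" for T
  proof (intro equalityI subsetI)
    fix F assume F: "F \<in> {F \<in> nsets (\<Union>L) k. touched F = T}"
    have "x \<in> \<Union>T" if x: "x \<in> F" for x
    proof -
      have "x \<in> \<Union>L" using F x by (auto simp: nsets_def)
      then obtain e where "e \<in> L" "x \<in> e" by (rule UnionE)
      moreover from this have "e \<in> touched F" using x by (auto simp: touched_def)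
      ultimately show ?thesis using F by blast
    qed
    moreover have "\<forall>e\<in>T. F \<inter> e \<noteq> {}" using F by (auto simp: touched_def)
    ultimately show "F \<in> crossing k T"
      using F by (simp add: crossing_def nsets_def subsetI)
  next
    fix F assume F: "F \<in> crossing k T"
    have "e \<in> T" if ex: "e \<in> L" "x \<in> F" "x \<in> e" for e x
    proof -
      have "x \<in> \<Union>T" using F ex(2) by (auto simp: crossing_def nsets_def)
      then obtain e' where "e' \<in> T" "x \<in> e'" by (rule UnionE)
      then show ?thesis using block_unique[of e e' x] ex T by auto
    qed
    then have "touched F = T"
      using F T unfolding touched_def crossing_def by blast
    moreover have "F \<in> nsets (\<Union>L) k"
      using F nsets_mono[OF Union_mono[OF T]] by (auto simp: crossing_def)
    ultimately show "F \<in> {F \<in> nsets (\<Union>L) k. touched F = T}" by simp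
  qed
  then have "(\<Sum>T\<in>Pow L. sum w (crossing k T)) =
      (\<Sum>T\<in>Pow L. sum w {F \<in> nsets (\<Union>L) k. touched F = T})"
    by (intro sum.cong refl) (simp add: eq)
  also have "\<dots> = sum w (nsets (\<Union>L) k)"
    using finite_L finite_imp_finite_nsets[OF finite_vertices]
    by (intro sum.group) (simp_all add: touched_def image_subset_iff)
  finally show ?thesis by simp
qed

text \<open>Moebius inversion over subfamilies: the crossing numbers of all subfamilies of
  \<open>T\<close> add up to the number of \<open>k\<close>-subsets of \<open>\<Union>T\<close>,
  which depends only on \<open>card T\<close>.\<close>

lemma card_crossing:
  "real (card (crossing k L)) =
     (\<Sum>i<card L. (-1) ^ i * real (card L choose i) * real ((k * (card L - i)) choose k))"
proof -
  \<comment> \<open>The inversion formula asks for its relation on all finite families, so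
    \<open>f\<close> is extended by \<open>0\<close> and \<open>g\<close> ignores members outside
    \<open>L\<close>.\<close>
  define f where "f T = (if T \<subseteq> L then real (card (crossing k T)) else 0)" for T
  define g where "g T = real (card (nsets (\<Union>(T \<inter> L)) k))" for T
  have g: "g T = sum f (Pow T)" if "finite T" for T
  proof -
    interpret T: block_system k "T \<inter> L" by (rule subsystem) auto
    have "g T = (\<Sum>T'\<in>Pow (T \<inter> L). real (card (crossing k T')))"
      using T.sum_nsets_by_crossing[of "\<lambda>_. 1"] by (simp add: g_def)
    also have "\<dots> = sum f (Pow (T \<inter> L))"
      by (intro sum.cong) (auto simp: f_def)
    also have "\<dots> = sum f (Pow T)"
      using that by (intro sum.mono_neutral_left) (auto simp: f_def)
    finally show ?thesis .
  qed
  have gT: "g T = real ((k * card T) choose k)" if "T \<subseteq> L" for T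
  proof -
    interpret T: block_system k T by (rule subsystem[OF that])
    have "nsets (\<Union>T) k = {N. N \<subseteq> \<Union>T \<and> card N = k}"
      using T.finite_vertices by (auto simp: nsets_def intro: finite_subset)
    then show ?thesis
      using that n_subsets[OF T.finite_vertices, of k] by (simp add: g_def T.card_vertices Int_absorb2)
  qed
  have "real (card (crossing k L)) = f L" by (simp add: f_def)
  also have "\<dots> = (\<Sum>T\<in>Pow L. (-1) ^ (card L - card T) * g T)"
    using g finite_L by (rule inclusion_exclusion_mobius)
  also have "\<dots> = (\<Sum>T\<in>Pow L. (-1) ^ (card L - card T) * real ((k * card T) choose k))"
    using gT by (intro sum.cong) auto
  also have "\<dots> = (\<Sum>j\<le>card L. (-1) ^ (card L - j) * real ((k * j) choose k) * real (card L choose j))"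
    using sum_Pow_by_card[OF finite_L, of "\<lambda>j. (-1) ^ (card L - j) * real ((k * j) choose k)"] .
  also have "\<dots> = (\<Sum>i\<le>card L. (-1) ^ i * real (card L choose i) * real ((k * (card L - i)) choose k))"
    by (rule sum.reindex_bij_witness[of _ "\<lambda>i. card L - i" "\<lambda>i. card L - i"])
      (auto dest: binomial_symmetric)
  \<comment> \<open>The last term vanishes because \<open>0 choose k\<close> is \<open>0\<close> for
    positive \<open>k\<close>.\<close>
  also have "\<dots> = (\<Sum>i<card L. (-1) ^ i * real (card L choose i) * real ((k * (card L - i)) choose k))"
    using k_pos by (simp add: lessThan_Suc_atMost[symmetric])
  finally show ?thesis .
qed

text \<open>By inclusion-exclusion the alternating sum in \<open>b_coeff\<close> counts crossing
  sets, so \<open>b_coeff\<close> is what remains when one crossing set in \<open>card L\<close> is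
  left out.\<close>

lemma b_coeff_eq: "b_coeff k (card L) = (real (card L) - 1) / card L * card (crossing k L)"
  by (simp add: b_coeff_def card_crossing)

text \<open>Picking a point of \<open>F\<close> in each block is injective because the blocks are
  disjoint, so \<open>F\<close> has at least \<open>card L\<close> points.\<close>

lemma crossing_empty_if_many_blocks:
  assumes "card L > k" shows "crossing k L = {}"
proof (rule ccontr)
  assume "crossing k L \<noteq> {}"
  then obtain F where F: "finite F" "card F = k" "\<And>e. e \<in> L \<Longrightarrow> F \<inter> e \<noteq> {}"
    by (auto simp: crossing_def nsets_def)
  then have "\<forall>e\<in>L. \<exists>x. x \<in> F \<inter> e" by blast
  then obtain p where p: "\<And>e. e \<in> L \<Longrightarrow> p e \<in> F \<inter> e" by metis
  have "inj_on p L"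
  proof (rule inj_onI)
    fix e e' assume "e \<in> L" "e' \<in> L" "p e = p e'"
    then show "e = e'" using p[of e] p[of e'] block_unique[of e e' "p e"] by simp
  qed
  then have "card L \<le> card F" using p F by (intro card_inj_on_le[of p]) auto
  then show False using assms F by simp
qed

text \<open>Splits the bound into one target per class. Single blocks need the separate value
  \<open>1\<close>, since \<open>b_coeff k 1\<close> is \<open>0\<close> while a block is its own
  crossing set; families of more than \<open>k\<close> blocks contribute nothing.\<close>

lemma f_bound_eq:
  assumes "k \<ge> 2"
  shows "f_bound k (card L) = (\<Sum>T\<in>Pow L. if card T = 1 then 1 else b_coeff k (card T))"
proof -
  let ?c = "\<lambda>j. if j = 1 then 1 else b_coeff k j" and ?m = "card L"
  have b0: "b_coeff k 0 = 0" by (simp add: b_coeff_def)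
  have bz: "b_coeff k j = 0" if j: "k < j" "j \<le> ?m" for j
  proof -
    obtain T where T: "T \<subseteq> L" "card T = j" using obtain_subset_with_card_n[OF j(2)] by metis
    interpret T: block_system k T by (rule subsystem[OF T(1)])
    show ?thesis using T.b_coeff_eq T.crossing_empty_if_many_blocks T j by simp
  qed
  have "(\<Sum>T\<in>Pow L. ?c (card T)) = (\<Sum>j\<le>?m. ?c j * (?m choose j))"
    by (rule sum_Pow_by_card[OF finite_L])
  \<comment> \<open>This range contains both index sets: terms beyond \<open>?m\<close> vanish
    through the binomial coefficient, and those beyond \<open>k\<close> by
    \<open>bz\<close>.\<close>
  also have "\<dots> = (\<Sum>j\<le>max k ?m. ?c j * (?m choose j))"
    by (rule sum.mono_neutral_left) auto
  also have "\<dots> = (\<Sum>j\<in>{1} \<union> {2..k}. ?c j * (?m choose j))"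
  proof (rule sum.mono_neutral_right)
    show "\<forall>j\<in>{..max k ?m} - ({1} \<union> {2..k}). ?c j * (?m choose j) = 0"
    proof
      fix j assume "j \<in> {..max k ?m} - ({1} \<union> {2..k})"
      then have "j = 0 \<or> k < j \<and> j \<noteq> 1" by auto
      then show "?c j * (?m choose j) = 0"
        using b0 bz by (cases "j \<le> ?m") auto
    qed
  qed (use assms in auto)
  also have "\<dots> = f_bound k ?m"
    by (subst sum.union_disjoint) (auto simp: f_bound_def intro!: sum.cong)
  finally show ?thesis by simp
qed

end

section \<open>Edges within a single crossing class\<close>

context block_system
begin

lemma card_edges_eq:
  assumes "E \<subseteq> nsets (\<Union>L) k"
  shows "real (card E) = (\<Sum>T\<in>Pow L. real (card (E \<inter> crossing k T)))"
proof -
  have "real (card E) = (\<Sum>F\<in>nsets (\<Union>L) k. of_bool (F \<in> E))"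
    using finite_imp_finite_nsets[OF finite_vertices] assms by (simp add: sum_of_bool_eq Int_absorb1)
  also have "\<dots> = (\<Sum>T\<in>Pow L. \<Sum>F\<in>crossing k T. of_bool (F \<in> E))"
    by (rule sum_nsets_by_crossing)
  also have "\<dots> = (\<Sum>T\<in>Pow L. real (card (E \<inter> crossing k T)))"
  proof (rule sum.cong[OF refl])
    fix T assume "T \<in> Pow L"
    then interpret T: block_system k T by (intro subsystem) simp
    show "(\<Sum>F\<in>crossing k T. of_bool (F \<in> E)) = real (card (E \<inter> crossing k T))"
      using T.finite_crossing by (simp add: sum_of_bool_eq Int_commute)
  qed
  finally show ?thesis .
qed

lemma crossing_singleton:
  assumes "e \<in> L" shows "crossing k {e} = {e}"
proof -
  have "F = e" if "F \<subseteq> e" "card F = k" for F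
    using card_subset_eq[OF finite_block[OF assms] that(1)] card_block[OF assms] that(2) by simp
  moreover have "e \<noteq> {}" using card_block[OF assms] k_pos by auto
  ultimately show ?thesis
    using finite_block[OF assms] card_block[OF assms] by (auto simp: crossing_def nsets_def)
qed

text \<open>A block meets no block other than itself. Hence sets crossing two or more blocks are
  genuinely new members when they replace matching edges.\<close>

lemma crossing_not_block:
  assumes F: "F \<in> crossing k T" and T: "T \<subseteq> L" "card T \<ge> 2"
  shows "F \<notin> L"
proof
  assume FL: "F \<in> L"
  have "e = F" if e: "e \<in> T" for e
  proof -
    obtain x where "x \<in> F" "x \<in> e" using F e by (auto simp: crossing_def)
    then show ?thesis using block_unique[of e F x] FL T e by auto
  qed
  then have "T \<subseteq> {F}" by blast
  then have "card T \<le> 1" using card_mono[of "{F}" T] by simp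
  then show False using T by simp
qed

text \<open>The small classes reach their targets exactly, for the upper bound and the construction
  alike: a single block is its only crossing set, and the empty family has none because
  \<open>k\<close> is positive.\<close>

lemma card_edges_crossing_few:
  assumes T: "T \<subseteq> L" "card T < 2" and LE: "L \<subseteq> E"
  shows "real (card (E \<inter> crossing k T)) = (if card T = 1 then 1 else b_coeff k (card T))"
proof (cases "card T = 1")
  case True
  then obtain e where e: "T = {e}" by (rule card_1_singletonE)
  then have "E \<inter> crossing k T = {e}" using crossing_singleton T LE by auto
  then show ?thesis using True by simp
next
  case False
  then have "T = {}" using T finite_L finite_subset[of T L] by (simp add: less_2_cases_iff)
  then show ?thesis using k_pos by (auto simp: crossing_def nsets_def b_coeff_def)
qed

text \<open>Exactly one part of a crossing partition contains \<open>y\<close>. Averaging the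
  indicator of this event and its negative gives the two inequalities.\<close>

lemma card_crossing_containing:
  assumes y: "y \<in> \<Union>L"
  shows "real (card L) * card {F \<in> crossing k L. y \<in> F} = card (crossing k L)"
proof -
  have sum1: "(\<Sum>j<card L. of_bool (y \<in> P j)) = (1::real)" if P: "crossing_partition P" for P
  proof -
    have "y \<in> (\<Union>j<card L. P j)" using P y by (simp add: crossing_partition_def)
    then obtain i where i: "i < card L" "y \<in> P i" by auto
    have disj: "disjoint_family_on P {..<card L}" using P by (simp add: crossing_partition_def)
    have "j = i" if "j < card L" "y \<in> P j" for j
    proof (rule ccontr)
      assume "j \<noteq> i"
      then have "P j \<inter> P i = {}"
        by (intro disjoint_family_onD[OF disj]) (use that i in simp_all)
      then show False using that i by blast
    qed
    then have "{..<card L} \<inter> {j. y \<in> P j} = {i}" using i by blast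
    then show ?thesis by (simp add: sum_of_bool_eq)
  qed
  have count: "(\<Sum>F\<in>crossing k L. of_bool (y \<in> F)) = real (card {F \<in> crossing k L. y \<in> F})"
    using finite_crossing by (simp add: sum_of_bool_eq Collect_conj_eq)
  have "1 * real (card (crossing k L)) \<le> card L * (\<Sum>F\<in>crossing k L. of_bool (y \<in> F) :: real)"
    by (rule crossing_averaging) (simp only: sum1 order_refl)
  moreover have "- 1 * real (card (crossing k L)) \<le> card L * (\<Sum>F\<in>crossing k L. - of_bool (y \<in> F) :: real)"
    by (rule crossing_averaging) (simp only: sum1 sum_negf order_refl)
  ultimately show ?thesis unfolding sum_negf count mult_minus_right by linarith
qed

lemma card_crossing_avoiding:
  assumes y: "y \<in> \<Union>L"
  shows "real (card {F \<in> crossing k L. y \<notin> F}) = b_coeff k (card L)"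
proof -
  let ?S = "crossing k L"
  have "L \<noteq> {}" using y by blast
  then have "real (card L) > 0" using finite_L by (simp add: card_gt_0_iff)
  moreover have "card ({F \<in> ?S. y \<in> F} \<union> {F \<in> ?S. y \<notin> F}) =
      card {F \<in> ?S. y \<in> F} + card {F \<in> ?S. y \<notin> F}"
    using finite_crossing by (intro card_Un_disjoint) auto
  moreover have "{F \<in> ?S. y \<in> F} \<union> {F \<in> ?S. y \<notin> F} = ?S" by blast
  ultimately show ?thesis
    unfolding b_coeff_eq using card_crossing_containing[OF y] by (simp add: field_simps)
qed

text \<open>A crossing partition of \<open>T\<close> consisting of edges could replace
  \<open>T\<close> in the matching, against uniqueness. So every such partition has a non-edge, and
  averaging its indicator makes at least one crossing set in \<open>card T\<close> a
  non-edge.\<close>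

lemma card_edges_crossing_le:
  assumes E: "E \<subseteq> nsets (\<Union>L) k" and LE: "L \<subseteq> E"
    and unique: "\<And>N. perfect_matching (card L) (\<Union>L) E N \<Longrightarrow> N = L"
    and T: "T \<subseteq> L" "card T \<ge> 2"
  shows "real (card (E \<inter> crossing k T)) \<le> b_coeff k (card T)"
proof -
  interpret T: block_system k T by (rule subsystem[OF T(1)])
  let ?S = "crossing k T" and ?l = "card T"
  have nonedge: "1 \<le> (\<Sum>j<?l. of_bool (P j \<notin> E) :: real)" if P: "T.crossing_partition P" for P
  proof (rule ccontr)
    assume "\<not> 1 \<le> (\<Sum>j<?l. of_bool (P j \<notin> E) :: real)"
    then have "real (card ({..<?l} \<inter> {j. P j \<notin> E})) < 1"
      by (simp only: sum_of_bool_eq not_le finite_lessThan)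
    then have "card ({..<?l} \<inter> {j. P j \<notin> E}) = 0" by linarith
    then have PE: "P j \<in> E" if "j < ?l" for j using that by auto
    have PS: "P j \<in> ?S" if "j < ?l" for j
      using P that by (auto simp: T.crossing_partition_def)
    have PL: "P j \<notin> L" if "j < ?l" for j
      using crossing_not_block[OF PS[OF that] T] .
    have PU: "(\<Union>j<?l. P j) = \<Union>T" and disj: "disjoint_family_on P {..<?l}"
      using P by (simp_all add: T.crossing_partition_def)
    have ne: "P j \<noteq> {}" if "j < ?l" for j
      using PS[OF that] k_pos by (auto simp: crossing_def nsets_def)
    \<comment> \<open>Disjoint nonempty parts are distinct, so the exchange preserves the number of
      edges.\<close>
    have inj: "inj_on P {..<?l}"
      using disj ne by (intro inj_onI) (metis Int_absorb disjoint_family_on_def lessThan_iff)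
    let ?N = "(L - T) \<union> P ` {..<?l}"
    have "card ?N = card (L - T) + card (P ` {..<?l})"
      using finite_L PL by (intro card_Un_disjoint) auto
    also have "\<dots> = card L"
      using card_image[OF inj] card_Diff_subset[OF T.finite_L T(1)] card_mono[OF finite_L T(1)] by simp
    finally have "card ?N = card L" .
    moreover have "?N \<subseteq> E" using LE PE by auto
    moreover have "disjoint ?N"
    proof (rule disjoint_union)
      show "disjoint (L - T)" using disjoint_L by (auto simp: disjoint_def)
      show "disjoint (P ` {..<?l})" using disjoint_family_on_disjoint_image[OF disj] .
      have "\<Union>(L - T) \<inter> \<Union>T = {}"
      proof (rule equals0I)
        fix x assume "x \<in> \<Union>(L - T) \<inter> \<Union>T"
        then obtain e e' where "e \<in> L - T" "e' \<in> T" "x \<in> e" "x \<in> e'" by blast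
        then show False using block_unique[of e e' x] T(1) by auto
      qed
      then show "\<Union>(L - T) \<inter> \<Union>(P ` {..<?l}) = {}" using PU by simp
    qed
    moreover have "\<Union>?N = \<Union>L"
    proof -
      have "\<Union>?N = \<Union>(L - T) \<union> \<Union>T" using PU by simp
      also have "\<dots> = \<Union>(L - T \<union> T)" by (simp only: Union_Un_distrib)
      also have "L - T \<union> T = L" using T(1) by blast
      finally show ?thesis .
    qed
    ultimately have "?N = L" by (intro unique) (simp add: perfect_matching_def)
    \<comment> \<open>Any part would do; index \<open>0\<close> exists because \<open>T\<close> is
      nonempty.\<close>
    then have "P 0 \<in> L" using T(2) by (metis UnI2 imageI lessThan_iff less_le_trans zero_less_numeral)
    then show False using PL[of 0] T(2) by simp
  qed
  have "1 * real (card ?S) \<le> ?l * (\<Sum>F\<in>?S. of_bool (F \<notin> E) :: real)"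
    by (rule T.crossing_averaging[OF nonedge])
  moreover have "(\<Sum>F\<in>?S. of_bool (F \<notin> E) :: real) = card (?S - E)"
    using T.finite_crossing by (simp add: sum_of_bool_eq Diff_eq Compl_eq)
  moreover have "card ?S = card (E \<inter> ?S) + card (?S - E)"
    using card_Int_Diff[OF T.finite_crossing, of E] by (simp only: Int_commute)
  ultimately have "?l * real (card (E \<inter> ?S)) \<le> (real ?l - 1) * real (card ?S)"
    by (simp add: algebra_simps)
  then show ?thesis
    unfolding T.b_coeff_eq using T(2) by (simp add: field_simps)
qed

end

section \<open>The upper bound, with the unique perfect matching as block system\<close>

lemma card_edges_le:
  assumes k: "k \<ge> 2" and m: "m \<ge> 1" and H: "uniform_hypergraph k V E" and V: "card V = k * m"
    and unique: "\<exists>!M. perfect_matching m V E M"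
  shows "real (card E) \<le> f_bound k m"
proof -
  obtain M where M: "perfect_matching m V E M" and M': "\<And>N. perfect_matching m V E N \<Longrightarrow> N = M"
    using unique by (elim ex1E) blast
  have E: "E \<subseteq> nsets V k" using H by (simp add: uniform_hypergraph_def)
  have ME: "M \<subseteq> E" and cM: "card M = m" and UM: "\<Union>M = V" and dM: "disjoint M"
    using M by (simp_all add: perfect_matching_def)
  interpret block_system k M
  proof
    \<comment> \<open>An infinite \<open>M\<close> would have cardinality \<open>0\<close>, which
      \<open>m \<ge> 1\<close> excludes.\<close>
    show "finite M" using cM m by (simp add: card_ge_0_finite)
    show "card e = k" if "e \<in> M" for e using that ME E by (auto simp: nsets_def)
  qed (use k dM in simp_all)
  have "real (card E) = (\<Sum>T\<in>Pow M. real (card (E \<inter> crossing k T)))"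
    by (rule card_edges_eq) (use E UM in simp)
  also have "\<dots> \<le> (\<Sum>T\<in>Pow M. if card T = 1 then 1 else b_coeff k (card T))"
  proof (rule sum_mono)
    fix T assume T: "T \<in> Pow M"
    show "real (card (E \<inter> crossing k T)) \<le> (if card T = 1 then 1 else b_coeff k (card T))"
    proof (cases "card T < 2")
      case True
      then show ?thesis using card_edges_crossing_few[of T E] T ME by simp
    next
      case False
      have "N = M" if "perfect_matching (card M) (\<Union>M) E N" for N
        using M' that cM UM by simp
      then have "real (card (E \<inter> crossing k T)) \<le> b_coeff k (card T)"
        using E UM ME T False by (intro card_edges_crossing_le) simp_all
      then show ?thesis using False by simp
    qed
  qed
  also have "\<dots> = f_bound k m" using f_bound_eq[OF k] cM by simp
  finally show ?thesis .
qed

subsection \<open>The extremal hypergraph\<close>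

text \<open>For positive \<open>k\<close> these are consecutive intervals of length
  \<open>k\<close>, with first vertex \<open>k * i\<close>; the form by division makes disjointness
  immediate.\<close>

definition nat_block :: "nat \<Rightarrow> nat \<Rightarrow> nat set" where
  "nat_block k i = {x. x div k = i}"

(* k dvd Min F says that F contains the first vertex of the first block it meets; such sets are
   excluded, apart from the blocks themselves. *)
definition extremal_edges :: "nat \<Rightarrow> nat \<Rightarrow> nat set set" where
  "extremal_edges k m = nat_block k ` {..<m} \<union> {F \<in> nsets {..<k * m} k. \<not> k dvd Min F}"

lemma first_in_nat_block: "k > 0 \<Longrightarrow> k * i \<in> nat_block k i"
  by (simp add: nat_block_def)

lemma nat_block_eq:
  assumes "k > 0" shows "nat_block k i = {k * i..<k * i + k}"
proof (rule set_eqI)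
  fix x
  have "x div k = i" if "k * i \<le> x" "x < k * i + k"
    by (rule div_nat_eqI) (use that in \<open>simp_all add: mult.commute\<close>)
  moreover have "k * (x div k) \<le> x" "x < k * (x div k) + k"
    using dividend_less_times_div[OF assms, of x] by simp_all
  ultimately show "x \<in> nat_block k i \<longleftrightarrow> x \<in> {k * i..<k * i + k}"
    by (auto simp: nat_block_def)
qed

lemma Union_nat_block: "k > 0 \<Longrightarrow> \<Union>(nat_block k ` {..<m}) = {..<k * m}"
  by (simp add: nat_block_def set_eq_iff div_less_iff_less_mult mult.commute)

lemma card_nat_blocks:
  assumes "k > 0" shows "card (nat_block k ` {..<m}) = m"
proof -
  have "i = j" if "nat_block k i = nat_block k j" for i j
    using first_in_nat_block[OF assms, of i] assms unfolding that by (simp add: nat_block_def)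
  then have "inj_on (nat_block k) {..<m}" by (intro inj_onI)
  then show ?thesis by (simp add: card_image)
qed

lemma block_system_nat_blocks:
  assumes "k > 0" shows "block_system k (nat_block k ` {..<m})"
proof
  show "disjoint (nat_block k ` {..<m})"
  proof (rule disjointI)
    fix a b assume "a \<in> nat_block k ` {..<m}" "b \<in> nat_block k ` {..<m}" "a \<noteq> b"
    then obtain i j where "a = nat_block k i" "b = nat_block k j" "i \<noteq> j" by blast
    then show "a \<inter> b = {}" by (auto simp: nat_block_def)
  qed
  show "card e = k" if "e \<in> nat_block k ` {..<m}" for e
    using that nat_block_eq[OF assms] by auto
qed (use assms in simp_all)

lemma extremal_edges_subset:
  assumes "k > 0" shows "extremal_edges k m \<subseteq> nsets {..<k * m} k"
proof -
  interpret block_system k "nat_block k ` {..<m}" by (rule block_system_nat_blocks[OF assms])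
  have "e \<in> nsets {..<k * m} k" if e: "e \<in> nat_block k ` {..<m}" for e
  proof -
    have "e \<subseteq> {..<k * m}" using Union_upper[OF e] unfolding Union_nat_block[OF assms] .
    then show ?thesis using card_block[OF e] finite_block[OF e] by (simp add: nsets_def)
  qed
  then show ?thesis unfolding extremal_edges_def by blast
qed

text \<open>The least vertex of \<open>\<Union>T\<close> is the first vertex of the first block of
  \<open>T\<close>. As \<open>F\<close> meets that block, \<open>Min F\<close> lies in it, where the
  only multiple of \<open>k\<close> is that first vertex. Within one class the edge condition thus
  means avoiding one fixed vertex.\<close>

lemma dvd_Min_crossing_iff:
  assumes k: "k > 0" and T: "T \<subseteq> nat_block k ` {..<m}" "T \<noteq> {}" and F: "F \<in> crossing k T"
  shows "k dvd Min F \<longleftrightarrow> Min (\<Union>T) \<in> F"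
proof -
  interpret T: block_system k T
    using block_system.subsystem[OF block_system_nat_blocks[OF k] T(1)] .
  have FT: "F \<subseteq> \<Union>T" and finF: "finite F" and cardF: "card F = k"
    using F by (auto simp: crossing_def nsets_def)
  have neF: "F \<noteq> {}" using cardF k by auto
  define y where "y = Min (\<Union>T)"
  have "y \<in> \<Union>T"
    unfolding y_def using neF FT by (intro Min_in[OF T.finite_vertices]) blast
  then obtain e where e: "e \<in> T" "y \<in> e" by (rule UnionE)
  then obtain i where "e = nat_block k i" using T by blast
  then have i: "e = nat_block k i" "y div k = i" using e by (simp_all add: nat_block_def)
  have "k * i \<in> \<Union>T" using e(1) i(1) first_in_nat_block[OF k] by blast
  then have "y \<le> k * i" unfolding y_def using T.finite_vertices by (rule Min_le[rotated])
  moreover have "k * i \<le> y" using i(2) by (metis times_div_less_eq_dividend)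
  ultimately have y: "y = k * i" by simp
  have yF: "y \<le> Min F"
    unfolding y_def using Min_antimono[OF FT neF T.finite_vertices] .
  have "F \<inter> e \<noteq> {}" using F e(1) by (simp add: crossing_def)
  then obtain z where z: "z \<in> F" "z div k = i" unfolding i(1) nat_block_def by blast
  have "Min F div k = i"
  proof (rule antisym)
    show "Min F div k \<le> i" using div_le_mono[OF Min_le[OF finF z(1)], of k] z by simp
    show "i \<le> Min F div k" using div_le_mono[OF yF, of k] i by simp
  qed
  show ?thesis
  proof
    assume "k dvd Min F"
    then have "Min F = y" using \<open>Min F div k = i\<close> y by (metis dvd_mult_div_cancel)
    then show "Min (\<Union>T) \<in> F" using Min_in[OF finF neF] y_def by simp
  next
    assume "Min (\<Union>T) \<in> F"
    then have "Min F = y" using yF Min_le[OF finF, of y] y_def by simp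
    then show "k dvd Min F" using y by simp
  qed
qed

text \<open>Every class attains its target: for two or more blocks its edges are the crossing sets
  avoiding \<open>Min (\<Union>T)\<close>, counted by \<open>card_crossing_avoiding\<close>.\<close>

lemma card_extremal_edges:
  assumes k: "k \<ge> 2"
  shows "real (card (extremal_edges k m)) = f_bound k m"
proof -
  have kp: "k > 0" using k by simp
  let ?M = "nat_block k ` {..<m}" and ?E = "extremal_edges k m"
  interpret block_system k ?M by (rule block_system_nat_blocks[OF kp])
  have E: "?E \<subseteq> nsets (\<Union>?M) k"
    using extremal_edges_subset[OF kp] Union_nat_block[OF kp] by simp
  have ME: "?M \<subseteq> ?E" by (simp add: extremal_edges_def)
  have "real (card ?E) = (\<Sum>T\<in>Pow ?M. real (card (?E \<inter> crossing k T)))"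
    by (rule card_edges_eq[OF E])
  also have "\<dots> = (\<Sum>T\<in>Pow ?M. if card T = 1 then 1 else b_coeff k (card T))"
  proof (rule sum.cong[OF refl])
    fix T assume "T \<in> Pow ?M"
    then have T: "T \<subseteq> ?M" by simp
    show "real (card (?E \<inter> crossing k T)) = (if card T = 1 then 1 else b_coeff k (card T))"
    proof (cases "card T < 2")
      case True
      then show ?thesis using card_edges_crossing_few[OF T _ ME] by simp
    next
      case False
      interpret T: block_system k T by (rule subsystem[OF T])
      have ne: "T \<noteq> {}" using False by auto
      have y: "Min (\<Union>T) \<in> \<Union>T"
      proof (rule Min_in[OF T.finite_vertices])
        show "\<Union>T \<noteq> {}" using ne T.card_block kp by fastforce
      qed
      have "F \<in> ?E \<longleftrightarrow> Min (\<Union>T) \<notin> F" if F: "F \<in> crossing k T" for F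
      proof -
        have "F \<notin> ?M" using crossing_not_block[OF F T] False by simp
        moreover have "F \<in> nsets {..<k * m} k"
          using F nsets_mono[OF Union_mono[OF T]] Union_nat_block[OF kp] by (auto simp: crossing_def)
        ultimately show ?thesis
          using dvd_Min_crossing_iff[OF kp T ne F] by (simp add: extremal_edges_def)
      qed
      then have "?E \<inter> crossing k T = {F \<in> crossing k T. Min (\<Union>T) \<notin> F}" by blast
      then show ?thesis using T.card_crossing_avoiding[OF y] False by simp
    qed
  qed
  also have "\<dots> = f_bound k m"
    using f_bound_eq[OF k] card_nat_blocks[OF kp, of m] by simp
  finally show ?thesis .
qed

text \<open>Strong induction on \<open>i\<close> puts block \<open>i\<close> into any perfect
  matching \<open>N\<close>. If the edge covering \<open>k * i\<close> is not a block, its minimum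
  is not a multiple of \<open>k\<close> and so lies in an earlier block, already in
  \<open>N\<close>; disjointness makes the edge equal to that block, a contradiction.\<close>

lemma unique_perfect_matching_extremal:
  assumes k: "k > 0"
  shows "\<exists>!M. perfect_matching m {..<k * m} (extremal_edges k m) M"
proof (rule ex1I)
  let ?M = "nat_block k ` {..<m}"
  interpret block_system k ?M by (rule block_system_nat_blocks[OF k])
  show "perfect_matching m {..<k * m} (extremal_edges k m) ?M"
    unfolding perfect_matching_def
    using disjoint_L card_nat_blocks[OF k] Union_nat_block[OF k] by (simp add: extremal_edges_def)
  fix N assume N: "perfect_matching m {..<k * m} (extremal_edges k m) N"
  have NE: "N \<subseteq> extremal_edges k m" and cN: "card N = m" and dN: "disjoint N"
    and UN: "\<Union>N = {..<k * m}"
    using N by (simp_all add: perfect_matching_def)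
  have "nat_block k i \<in> N" if "i < m" for i
    using that
  proof (induction i rule: less_induct)
    case (less i)
    have "k * i \<in> \<Union>N" using less.prems k UN by simp
    then obtain F where F: "F \<in> N" "k * i \<in> F" by (rule UnionE)
    show ?case
    proof (cases "F \<in> ?M")
      case True
      then obtain j where "F = nat_block k j" by blast
      moreover from this have "j = i" using F(2) k by (simp add: nat_block_def)
      ultimately show ?thesis using F by simp
    next
      case False
      then have FS: "F \<in> nsets {..<k * m} k" "\<not> k dvd Min F"
        using F(1) NE by (auto simp: extremal_edges_def)
      have finF: "finite F" using FS by (simp add: nsets_def)
      let ?j = "Min F div k"
      have "Min F \<le> k * i" using finF F(2) by (rule Min_le)
      moreover have "Min F \<noteq> k * i" using FS(2) by auto
      ultimately have "?j < i" using k by (simp add: div_less_iff_less_mult mult.commute)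
      then have jN: "nat_block k ?j \<in> N" using less by simp
      have "Min F \<in> F" using finF F(2) by (intro Min_in) auto
      moreover have "Min F \<in> nat_block k ?j" by (simp add: nat_block_def)
      ultimately have "F = nat_block k ?j"
        using dN jN F(1) by (auto simp: disjoint_def)
      then have "F \<in> ?M" using \<open>?j < i\<close> less.prems by simp
      then show ?thesis using False by simp
    qed
  qed
  then have "?M \<subseteq> N" by blast
  moreover have "finite N" using UN by (metis finite_UnionD finite_lessThan)
  ultimately show "N = ?M"
    using card_subset_eq[of N ?M] cN card_nat_blocks[OF k, of m] by simp
qed

theorem theorem1:
  fixes k m :: nat
  assumes "k \<ge> 2" and "m \<ge> 1"
  shows "(\<forall>(V :: 'a set) E. uniform_hypergraph k V E \<and> card V = k * m \<and>
            (\<exists>!M. perfect_matching m V E M) \<longrightarrow> real (card E) \<le> f_bound k m) \<and>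
         (\<exists>(V :: nat set) E. uniform_hypergraph k V E \<and> card V = k * m \<and>
            (\<exists>!M. perfect_matching m V E M) \<and> real (card E) = f_bound k m)"
proof (intro conjI allI impI)
  fix V :: "'a set" and E
  assume "uniform_hypergraph k V E \<and> card V = k * m \<and> (\<exists>!M. perfect_matching m V E M)"
  then show "real (card E) \<le> f_bound k m" using card_edges_le[OF assms] by blast
next
  have k: "k > 0" using assms by simp
  have "uniform_hypergraph k {..<k * m} (extremal_edges k m)"
    using extremal_edges_subset[OF k] by (simp add: uniform_hypergraph_def)
  then show "\<exists>(V :: nat set) E. uniform_hypergraph k V E \<and> card V = k * m \<and>
      (\<exists>!M. perfect_matching m V E M) \<and> real (card E) = f_bound k m"
    using unique_perfect_matching_extremal[OF k, of m] card_extremal_edges[OF assms(1), of m]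
    by (intro exI[of _ "{..<k * m}"] exI[of _ "extremal_edges k m"]) simp
qed

end
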